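(* Let $G=(V,E)$ be a finite graph with maximum degree at most $2$ and let $n\geq 1$ be an integer. Then $I_n(G)$ is $2(n-1)$-collapsible.
   Context: For a graph $G=(V,E)$, $I_n(G)=\{U\subseteq V:\ \alpha(G[U])<n\}$, where $\alpha$ is the independence number. For a finite simplicial complex $X$, a face $\sigma$ contained in a unique maximal face $\tau$ is a free face; if $|\sigma|\leq d$, removing all faces $\eta$ with $\sigma\subseteq\eta\subseteq\tau$ is an elementary $d$-collapse. $X$ is $d$-collapsible if a sequence of elementary $d$-collapses reduces it to the void complex (no faces at all). *)

theory Defs
  imports "HOL-Library.Ramsey"
begin

text \<open>Graphs are finite and simple: an edge is a two-element set of vertices.\<close>

definition finite_graph :: "'a set \<Rightarrow> 'a set set \<Rightarrow> bool" where
  "finite_graph V E \<longleftrightarrow> finite V \<and> E \<subseteq> [V]\<^bsup>2\<^esup>"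

definition vertex_degree :: "'a set set \<Rightarrow> 'a \<Rightarrow> nat" where
  "vertex_degree E v = card {e \<in> E. v \<in> e}"

text \<open>The inserted \<open>0\<close> only matters for the graph without vertices.\<close>

definition max_degree :: "'a set \<Rightarrow> 'a set set \<Rightarrow> nat" where
  "max_degree V E = Max (insert 0 (vertex_degree E ` V))"

definition induced_edges :: "'a set set \<Rightarrow> 'a set \<Rightarrow> 'a set set" where
  "induced_edges E U = {e \<in> E. e \<subseteq> U}"

definition independence_number :: "'a set \<Rightarrow> 'a set set \<Rightarrow> nat" where
  "independence_number V E = Max (card ` {S. S \<subseteq> V \<and> indep S E})"

definition independence_complex :: "nat \<Rightarrow> 'a set \<Rightarrow> 'a set set \<Rightarrow> 'a set set" where
  "independence_complex n V E =
     {U. U \<subseteq> V \<and> independence_number U (induced_edges E U) < n}"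

text \<open>
  A complex is the set of its faces, the empty face included. Hence the void complex \<open>{}\<close>
  differs from \<open>{{}}\<close>, whose only face is the empty one.
\<close>

definition finite_complex :: "'a set set \<Rightarrow> bool" where
  "finite_complex X \<longleftrightarrow>
     finite X \<and> (\<forall>\<sigma>\<in>X. finite \<sigma>) \<and> (\<forall>\<sigma>\<in>X. \<forall>\<eta>. \<eta> \<subseteq> \<sigma> \<longrightarrow> \<eta> \<in> X)"

definition maximal_face :: "'a set set \<Rightarrow> 'a set \<Rightarrow> bool" where
  "maximal_face X \<tau> \<longleftrightarrow> \<tau> \<in> X \<and> (\<forall>\<rho>\<in>X. \<tau> \<subseteq> \<rho> \<longrightarrow> \<rho> = \<tau>)"

text \<open>As usual for \<open>d\<close>-collapses, \<open>\<sigma> = \<tau>\<close> is allowed.\<close>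

definition free_face_in :: "'a set set \<Rightarrow> 'a set \<Rightarrow> 'a set \<Rightarrow> bool" where
  "free_face_in X \<sigma> \<tau> \<longleftrightarrow> \<sigma> \<in> X \<and> maximal_face X \<tau> \<and> \<sigma> \<subseteq> \<tau> \<and>
     (\<forall>\<rho>. maximal_face X \<rho> \<and> \<sigma> \<subseteq> \<rho> \<longrightarrow> \<rho> = \<tau>)"

definition elementary_collapse :: "nat \<Rightarrow> 'a set set \<Rightarrow> 'a set set \<Rightarrow> bool" where
  "elementary_collapse d X Y \<longleftrightarrow>
     (\<exists>\<sigma> \<tau>. free_face_in X \<sigma> \<tau> \<and> card \<sigma> \<le> d \<and> Y = X - {\<eta>. \<sigma> \<subseteq> \<eta> \<and> \<eta> \<subseteq> \<tau>})"

definition collapsible :: "nat \<Rightarrow> 'a set set \<Rightarrow> bool" where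
  "collapsible d X \<longleftrightarrow> finite_complex X \<and> (elementary_collapse d)\<^sup>*\<^sup>* X {}"

end

theory Submission
  imports Defs
begin

text \<open>
  Two facts drive the proof. First, if the deletion of a vertex \<open>v\<close> is \<open>d\<close>-collapsible and its
  link is \<open>(d - 1)\<close>-collapsible, then the complex is \<open>d\<close>-collapsible (Tancer). Second, write
  \<open>X\<^sub>k(G)\<close> for the complex of vertex sets \<open>U\<close> with \<open>\<alpha>(G[U]) \<le> k\<close>. If the neighbourhood \<open>N\<close> of
  \<open>v\<close> is a clique, the link of \<open>v\<close> in \<open>X\<^sub>k\<^sub>+\<^sub>1(G)\<close> is the join of \<open>X\<^sub>k(G - N[v])\<close> with the simplex
  on \<open>N\<close>. If a graph of maximum degree at most \<open>2\<close> has no such vertex, there is a path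
  \<open>c a v b\<close> whose inner vertices have degree \<open>2\<close>. In the link of \<open>v\<close>, deleting \<open>a\<close> turns
  \<open>v\<close> into a vertex whose neighbourhood is a clique, while the link of \<open>a\<close> is \<open>X\<^sub>k(G')\<close>, where
  \<open>G'\<close> arises from \<open>G\<close> by replacing the path \<open>c a v b\<close> with an edge \<open>c b\<close>. So an induction on the
  number of vertices applies, at a cost of two dimensions for each unit of \<open>k\<close>.
\<close>

section \<open>Collapses\<close>

text \<open>\<open>collapsible\<close> without \<open>finite_complex\<close>: the lemmas on
  collapses below hold for arbitrary families of sets, so closure under subsets is checked only
  once, at the very end.\<close>

definition collapses_to_void :: "nat \<Rightarrow> 'a set set \<Rightarrow> bool" where
  "collapses_to_void d X \<longleftrightarrow> (elementary_collapse d)\<^sup>*\<^sup>* X {}"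

lemma elementary_collapse_mono:
  "elementary_collapse d X Y \<Longrightarrow> d \<le> d' \<Longrightarrow> elementary_collapse d' X Y"
  unfolding elementary_collapse_def using le_trans by blast

lemma collapses_to_void_mono:
  assumes "collapses_to_void d X" "d \<le> d'"
  shows "collapses_to_void d' X"
proof -
  have "elementary_collapse d \<le> elementary_collapse d'"
    using elementary_collapse_mono assms(2) by blast
  then show ?thesis
    using assms(1) rtranclp_mono unfolding collapses_to_void_def by blast
qed

lemma elementary_collapse_subset: "elementary_collapse d X Y \<Longrightarrow> Y \<subseteq> X"
  unfolding elementary_collapse_def by auto

lemma collapses_to_void_empty_face: "collapses_to_void d {{}}"
proof -
  have "elementary_collapse d {{}} {}"
    unfolding elementary_collapse_def free_face_in_def maximal_face_def
    by (intro exI[of _ "{}"]) auto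
  then show ?thesis
    unfolding collapses_to_void_def by blast
qed

text \<open>Adding \<open>v\<close> to the free face and to its maximal face lifts a collapse of
  \<open>L\<close>. Members of \<open>A\<close> avoid \<open>v\<close>, so the maximal faces above
  \<open>insert v s\<close> correspond to those of \<open>L\<close> above \<open>s\<close>. The
  dimension grows by one because \<open>v\<close> joins the free face.\<close>

lemma elementary_collapse_insert_vertex:
  assumes "elementary_collapse d L L'"
    and A: "\<forall>U\<in>A. v \<notin> U" and L: "\<forall>U\<in>L. v \<notin> U"
  shows "elementary_collapse (Suc d) (A \<union> insert v ` L) (A \<union> insert v ` L')"
proof -
  obtain s t where free: "free_face_in L s t" and "card s \<le> d"
    and L': "L' = L - {u. s \<subseteq> u \<and> u \<subseteq> t}"
    using assms(1) unfolding elementary_collapse_def by blast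
  let ?X = "A \<union> insert v ` L"
  have st: "s \<in> L" "t \<in> L" "s \<subseteq> t" "v \<notin> s" "v \<notin> t"
    using free L unfolding free_face_in_def maximal_face_def by auto
  have maximal: "maximal_face ?X (insert v r) \<longleftrightarrow> maximal_face L r" if "r \<in> L" for r
  proof -
    have "insert v r \<subseteq> insert v q \<longleftrightarrow> r \<subseteq> q" "insert v q = insert v r \<longleftrightarrow> q = r" if "q \<in> L" for q
      using L that \<open>r \<in> L\<close> by (auto simp: insert_ident)
    then show ?thesis
      using A \<open>r \<in> L\<close> unfolding maximal_face_def by auto
  qed
  have unique: "r = insert v t" if "maximal_face ?X r" "insert v s \<subseteq> r" for r
  proof -
    have "r \<in> ?X" "v \<in> r"
      using that unfolding maximal_face_def by auto
    then obtain q where q: "r = insert v q" "q \<in> L"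
      using A by blast
    then have "maximal_face L q" "s \<subseteq> q"
      using maximal that \<open>v \<notin> s\<close> by auto
    then show ?thesis
      using free q unfolding free_face_in_def by blast
  qed
  have "free_face_in ?X (insert v s) (insert v t)"
    using free st maximal unique unfolding free_face_in_def by auto
  moreover have "card (insert v s) \<le> Suc d"
    using \<open>card s \<le> d\<close> card_insert_le_m1[of "Suc d" s v] by simp
  moreover have "A \<union> insert v ` L' = ?X - {u. insert v s \<subseteq> u \<and> u \<subseteq> insert v t}"
  proof -
    have "insert v s \<subseteq> insert v q \<and> insert v q \<subseteq> insert v t \<longleftrightarrow> s \<subseteq> q \<and> q \<subseteq> t"
      if "q \<in> L" for q
      using L that st by auto
    then show ?thesis
      using A unfolding L' by (auto simp: image_iff)
  qed
  ultimately show ?thesis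
    unfolding elementary_collapse_def by blast
qed

text \<open>The collapses of the link, lifted by \<open>v\<close>, first remove all faces containing
  \<open>v\<close>; then the deletion is collapsed on its own.\<close>

lemma collapses_to_void_deletion_link:
  assumes deletion: "collapses_to_void (Suc d) {U \<in> X. v \<notin> U}"
    and link: "collapses_to_void d {U. v \<notin> U \<and> insert v U \<in> X}"
  shows "collapses_to_void (Suc d) X"
proof -
  let ?A = "{U \<in> X. v \<notin> U}" and ?L = "{U. v \<notin> U \<and> insert v U \<in> X}"
  \<comment> \<open>That \<open>M\<close> stays inside \<open>?L\<close> keeps \<open>v\<close> out
    of every face of \<open>M\<close>, as the lifting lemma requires.\<close>
  have "(elementary_collapse (Suc d))\<^sup>*\<^sup>* (?A \<union> insert v ` ?L) (?A \<union> insert v ` M) \<and> M \<subseteq> ?L"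
    if "(elementary_collapse d)\<^sup>*\<^sup>* ?L M" for M
    using that
  proof (induction rule: rtranclp_induct)
    case (step M M')
    then have "elementary_collapse (Suc d) (?A \<union> insert v ` M) (?A \<union> insert v ` M')"
      by (intro elementary_collapse_insert_vertex) auto
    then show ?case
      using step elementary_collapse_subset[of d M M'] by (meson rtranclp.rtrancl_into_rtrancl subset_trans)
  qed simp
  from this[of "{}"] link have "(elementary_collapse (Suc d))\<^sup>*\<^sup>* (?A \<union> insert v ` ?L) ?A"
    unfolding collapses_to_void_def by simp
  moreover have "?A \<union> insert v ` ?L = X"
  proof -
    have "U \<in> insert v ` ?L" if "U \<in> X" "v \<in> U" for U
      using that by (intro image_eqI[of _ _ "U - {v}"]) (auto simp: insert_absorb)
    then show ?thesis
      by auto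
  qed
  ultimately show ?thesis
    using deletion unfolding collapses_to_void_def by simp
qed

text \<open>\<open>{U. U - B \<in> Z}\<close> is the join of \<open>Z\<close> with the full simplex
  on \<open>B\<close>. Vertices of \<open>B\<close> can be added to any face, so each maximal face
  is a maximal face of \<open>Z\<close> together with all of \<open>B\<close>. The free face
  \<open>s\<close> is left as it is, hence the same \<open>d\<close>.\<close>

lemma elementary_collapse_join_simplex:
  assumes "elementary_collapse d Z Z'" and Z: "\<forall>U\<in>Z. U \<inter> B = {}"
  shows "elementary_collapse d {U. U - B \<in> Z} {U. U - B \<in> Z'}"
proof -
  obtain s t where free: "free_face_in Z s t" and "card s \<le> d"
    and Z': "Z' = Z - {u. s \<subseteq> u \<and> u \<subseteq> t}"
    using assms(1) unfolding elementary_collapse_def by blast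
  let ?J = "{U. U - B \<in> Z}"
  have st: "s \<in> Z" "t \<in> Z" "s \<subseteq> t" "s \<inter> B = {}" "t \<inter> B = {}"
    and t_max: "\<And>q. q \<in> Z \<Longrightarrow> t \<subseteq> q \<Longrightarrow> q = t"
    using free Z unfolding free_face_in_def maximal_face_def by auto
  have diff: "s - B = s" "(t \<union> B) - B = t"
    using st by auto
  have t_maximal: "maximal_face ?J (t \<union> B)"
    unfolding maximal_face_def
  proof (intro conjI ballI impI)
    show "t \<union> B \<in> ?J"
      using st diff by simp
    fix r assume "r \<in> ?J" "t \<union> B \<subseteq> r"
    then have "r - B = t"
      using t_max[of "r - B"] st by auto
    then show "r = t \<union> B"
      using \<open>t \<union> B \<subseteq> r\<close> by auto
  qed
  have unique: "r = t \<union> B" if r: "maximal_face ?J r" "s \<subseteq> r" for r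
  proof -
    have "r - B \<in> Z"
      using r unfolding maximal_face_def by auto
    \<comment> \<open>Used twice: the extension \<open>r \<union> B\<close> shows that
      \<open>r\<close> contains \<open>B\<close>, and the extensions \<open>q \<union> B\<close>
      show that \<open>r - B\<close> is maximal in \<open>Z\<close>.\<close>
    have absorb: "q = r" if "q - B \<in> Z" "r \<subseteq> q" for q
      using r that unfolding maximal_face_def by auto
    have "B \<subseteq> r"
      using absorb[of "r \<union> B"] \<open>r - B \<in> Z\<close> by (auto simp: Un_Diff)
    have "q = r - B" if "q \<in> Z" "r - B \<subseteq> q" for q
    proof -
      have "(q \<union> B) - B = q"
        using Z that by auto
      then have "q \<union> B = r"
        using absorb[of "q \<union> B"] that by auto
      with \<open>(q \<union> B) - B = q\<close> show ?thesis
        by simp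
    qed
    then have "maximal_face Z (r - B)"
      using \<open>r - B \<in> Z\<close> unfolding maximal_face_def by auto
    moreover have "s \<subseteq> r - B"
      using r st by auto
    ultimately have "r - B = t"
      using free unfolding free_face_in_def by blast
    with \<open>B \<subseteq> r\<close> show ?thesis
      by auto
  qed
  have "free_face_in ?J s (t \<union> B)"
    using st diff t_maximal unique unfolding free_face_in_def by auto
  moreover have "{U. U - B \<in> Z'} = ?J - {u. s \<subseteq> u \<and> u \<subseteq> t \<union> B}"
    unfolding Z' using st by auto
  ultimately show ?thesis
    using \<open>card s \<le> d\<close> unfolding elementary_collapse_def by blast
qed

lemma collapses_to_void_join_simplex:
  assumes "collapses_to_void d Z" and "\<forall>U\<in>Z. U \<inter> B = {}"
  shows "collapses_to_void d {U. U - B \<in> Z}"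
proof -
  have "(elementary_collapse d)\<^sup>*\<^sup>* {U. U - B \<in> Z} {U. U - B \<in> M} \<and> M \<subseteq> Z"
    if "(elementary_collapse d)\<^sup>*\<^sup>* Z M" for M
    using that
  proof (induction rule: rtranclp_induct)
    case (step M M')
    then have "elementary_collapse d {U. U - B \<in> M} {U. U - B \<in> M'}"
      using assms(2) by (intro elementary_collapse_join_simplex) auto
    then show ?case
      using step elementary_collapse_subset[of d M M'] by (meson rtranclp.rtrancl_into_rtrancl subset_trans)
  qed simp
  from this[of "{}"] show ?thesis
    using assms(1) unfolding collapses_to_void_def by simp
qed

section \<open>Links in the complex of vertex sets of bounded independence number\<close>

definition nbrs :: "'a set \<Rightarrow> 'a set set \<Rightarrow> 'a \<Rightarrow> 'a set" where
  "nbrs V E x = {y \<in> V. y \<noteq> x \<and> {x, y} \<in> E}"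

text \<open>
  The edge set \<open>E\<close> is not restricted to \<open>V\<close>, so deleting vertices only changes \<open>V\<close>.
\<close>

definition bounded_indep_complex :: "'a set \<Rightarrow> 'a set set \<Rightarrow> nat \<Rightarrow> 'a set set" where
  "bounded_indep_complex V E k = {U. U \<subseteq> V \<and> (\<forall>S\<subseteq>U. indep S E \<longrightarrow> card S \<le> k)}"

lemma indep_subset: "indep S E \<Longrightarrow> T \<subseteq> S \<Longrightarrow> indep T E"
  unfolding indep_def by blast

lemma indep_insert:
  "indep (insert x S) E \<longleftrightarrow> indep S E \<and> (\<forall>y\<in>S. y \<noteq> x \<longrightarrow> {x, y} \<notin> E)"
  unfolding indep_def by (auto simp: insert_commute)

lemma nbrs_diff: "nbrs (V - W) E x = nbrs V E x - W"
  unfolding nbrs_def by auto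

lemma nbrs_sym: "x \<in> V \<Longrightarrow> y \<in> nbrs V E x \<Longrightarrow> x \<in> nbrs V E y"
  unfolding nbrs_def by (auto simp: insert_commute)

lemma finite_nbrs: "finite V \<Longrightarrow> finite (nbrs V E x)"
  unfolding nbrs_def by simp

lemma bounded_indep_complex_deletion:
  "{U \<in> bounded_indep_complex V E k. v \<notin> U} = bounded_indep_complex (V - {v}) E k"
  unfolding bounded_indep_complex_def by auto

lemma bounded_indep_complex_0:
  assumes "finite V"
  shows "bounded_indep_complex V E 0 = {{}}"
proof -
  have "U = {}" if "U \<in> bounded_indep_complex V E 0" for U
  proof (rule ccontr)
    assume "U \<noteq> {}"
    then obtain x where "x \<in> U"
      by blast
    moreover have "indep {x} E"
      by (simp add: indep_def)
    ultimately have "card {x} \<le> 0"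
      using that unfolding bounded_indep_complex_def by blast
    then show False
      by simp
  qed
  then show ?thesis
    unfolding bounded_indep_complex_def by auto
qed

text \<open>An independent set avoiding \<open>v\<close> and its neighbours can be enlarged by
  \<open>v\<close>. Conversely, \<open>v\<close> and its neighbours form a clique, so an independent
  set loses at most one element when they are removed.\<close>

lemma bounded_indep_complex_simplicial_link:
  assumes "finite V" "v \<in> V" and clique: "clique (nbrs V E v) E"
  shows "{U. v \<notin> U \<and> insert v U \<in> bounded_indep_complex V E (Suc k)} =
    {U. U - nbrs V E v \<in> bounded_indep_complex (V - insert v (nbrs V E v)) E k}"
proof -
  let ?N = "nbrs V E v"
  have "(v \<notin> U \<and> insert v U \<in> bounded_indep_complex V E (Suc k)) \<longleftrightarrow>
      U - ?N \<in> bounded_indep_complex (V - insert v ?N) E k" for U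
  proof (intro iffI; (elim conjE)?)
    assume v: "v \<notin> U" and U: "insert v U \<in> bounded_indep_complex V E (Suc k)"
    have "card S \<le> k" if S: "S \<subseteq> U - ?N" "indep S E" for S
    proof -
      have "S \<subseteq> V" "v \<notin> S"
        using S v U unfolding bounded_indep_complex_def by auto
      then have "indep (insert v S) E"
        using S unfolding indep_insert nbrs_def by auto
      then have "card (insert v S) \<le> Suc k"
        using S U unfolding bounded_indep_complex_def by blast
      then show ?thesis
        using \<open>v \<notin> S\<close> \<open>S \<subseteq> V\<close> \<open>finite V\<close> by (simp add: finite_subset)
    qed
    then show "U - ?N \<in> bounded_indep_complex (V - insert v ?N) E k"
      using v U unfolding bounded_indep_complex_def by auto
  next
    assume U: "U - ?N \<in> bounded_indep_complex (V - insert v ?N) E k"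
    have "?N \<subseteq> V" "v \<notin> ?N"
      unfolding nbrs_def by auto
    then have "v \<notin> U" "U \<subseteq> V"
      using U unfolding bounded_indep_complex_def by auto
    have "card S \<le> Suc k" if S: "S \<subseteq> insert v U" "indep S E" for S
    proof -
      have "card (S - insert v ?N) \<le> k"
      proof -
        have "S - insert v ?N \<subseteq> U - ?N"
          using S by auto
        then show ?thesis
          using U indep_subset[OF S(2) Diff_subset] unfolding bounded_indep_complex_def by simp
      qed
      moreover have "card (S \<inter> insert v ?N) \<le> 1"
      proof -
        have "x = y" if "x \<in> S \<inter> insert v ?N" "y \<in> S \<inter> insert v ?N" for x y
        proof (rule ccontr)
          assume "x \<noteq> y"
          moreover have "{v, z} \<in> E \<and> {z, v} \<in> E" if "z \<in> ?N" for z
            using that unfolding nbrs_def by (simp add: insert_commute)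
          ultimately have "{x, y} \<in> E"
            using that clique unfolding clique_def by auto
          then show False
            using that \<open>x \<noteq> y\<close> S(2) unfolding indep_def by auto
        qed
        moreover have "finite (S \<inter> insert v ?N)"
          using \<open>finite V\<close> by (simp add: finite_nbrs)
        ultimately show ?thesis
          by (simp add: card_le_Suc0_iff_eq)
      qed
      moreover have "card S \<le> card (S - insert v ?N) + card (S \<inter> insert v ?N)"
        using card_Un_le[of "S - insert v ?N" "S \<inter> insert v ?N"] by (simp add: Un_Diff_Int)
      ultimately show ?thesis
        by simp
    qed
    then show "v \<notin> U \<and> insert v U \<in> bounded_indep_complex V E (Suc k)"
      using \<open>v \<notin> U\<close> \<open>U \<subseteq> V\<close> \<open>v \<in> V\<close> unfolding bounded_indep_complex_def by auto
  qed
  then show ?thesis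
    by auto
qed

lemma simplicial_link_collapses_to_void:
  assumes "finite V" "v \<in> V" "clique (nbrs V E v) E"
    and "collapses_to_void d (bounded_indep_complex (V - insert v (nbrs V E v)) E k)"
  shows "collapses_to_void d {U. v \<notin> U \<and> insert v U \<in> bounded_indep_complex V E (Suc k)}"
  unfolding bounded_indep_complex_simplicial_link[OF assms(1-3)]
  by (rule collapses_to_void_join_simplex[OF assms(4)]) (auto simp: bounded_indep_complex_def)

text \<open>An independent set of the new graph misses \<open>b\<close> or \<open>c\<close>, so
  \<open>v\<close> or \<open>a\<close> can be added to it in the old graph. Conversely, an
  independent set of the old graph becomes one of the new graph after losing at most one
  vertex.\<close>

lemma bounded_indep_complex_path_link:
  assumes "finite V" "v \<in> V" "a \<in> V"
    and nv: "nbrs V E v = {a, b}" and na: "nbrs V E a = {v, c}" and "b \<noteq> c" "b \<noteq> a" "c \<noteq> v"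
  shows "{U. a \<notin> U \<and> v \<notin> U \<and> insert v (insert a U) \<in> bounded_indep_complex V E (Suc k)} =
    bounded_indep_complex (V - {v, a}) (insert {c, b} E) k"
proof -
  let ?E = "insert {c, b} E"
  have "v \<noteq> a" and va: "{v, a} \<in> E"
    using nv unfolding nbrs_def by auto
  have "(a \<notin> U \<and> v \<notin> U \<and> insert v (insert a U) \<in> bounded_indep_complex V E (Suc k)) \<longleftrightarrow>
      U \<in> bounded_indep_complex (V - {v, a}) ?E k" for U
  proof (intro iffI; (elim conjE)?)
    assume av: "a \<notin> U" "v \<notin> U"
      and U: "insert v (insert a U) \<in> bounded_indep_complex V E (Suc k)"
    have "card S \<le> k" if S: "S \<subseteq> U" "indep S ?E" for S
    proof -
      have SV: "S \<subseteq> V" "v \<notin> S" "a \<notin> S"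
        using S av U unfolding bounded_indep_complex_def by auto
      have "c \<notin> S \<or> b \<notin> S"
        using S(2) \<open>b \<noteq> c\<close> unfolding indep_def by auto
      moreover have "indep S E"
        using S(2) unfolding indep_def by auto
      moreover have "y = b" if "y \<in> S" "{v, y} \<in> E" for y
      proof -
        have "y \<in> nbrs V E v"
          using that SV unfolding nbrs_def by auto
        then show ?thesis
          using nv that SV by auto
      qed
      moreover have "y = c" if "y \<in> S" "{a, y} \<in> E" for y
      proof -
        have "y \<in> nbrs V E a"
          using that SV unfolding nbrs_def by auto
        then show ?thesis
          using na that SV by auto
      qed
      ultimately have "indep (insert v S) E \<or> indep (insert a S) E"
        unfolding indep_insert by blast
      then obtain x where x: "x \<in> {v, a}" "indep (insert x S) E"
        by blast
      then have "card (insert x S) \<le> Suc k"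
        using S U unfolding bounded_indep_complex_def by blast
      then show ?thesis
        using x SV \<open>finite V\<close> by (auto simp: finite_subset)
    qed
    then show "U \<in> bounded_indep_complex (V - {v, a}) ?E k"
      using av U unfolding bounded_indep_complex_def by auto
  next
    assume U: "U \<in> bounded_indep_complex (V - {v, a}) ?E k"
    have "card S \<le> Suc k" if S: "S \<subseteq> insert v (insert a U)" "indep S E" for S
    proof -
      have bound: "card T \<le> k" if "T \<subseteq> S - {v, a}" "c \<notin> T \<or> b \<notin> T" for T
      proof -
        have "indep T ?E"
          using that indep_subset[OF S(2), of T] unfolding indep_def
          by (auto simp: doubleton_eq_iff)
        moreover have "T \<subseteq> U"
          using S(1) that(1) by blast
        ultimately show ?thesis
          using U unfolding bounded_indep_complex_def by blast
      qed
      \<comment> \<open>If \<open>S\<close> contains both \<open>b\<close> and \<open>c\<close>, it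
        contains neither \<open>v\<close> nor \<open>a\<close>, and dropping \<open>b\<close>
        suffices. Otherwise the vertex to drop is whichever of \<open>v\<close> and \<open>a\<close>
        lies in \<open>S\<close>, if any.\<close>
      have "\<exists>x. card (S - {x}) \<le> k"
      proof (cases "c \<in> S \<and> b \<in> S")
        case True
        have "b \<in> nbrs V E v" "c \<in> nbrs V E a"
          using nv na by auto
        then have "v \<notin> S" "a \<notin> S"
          using True S(2) unfolding indep_def nbrs_def by auto
        then have "S - {b} \<subseteq> S - {v, a}"
          by blast
        then show ?thesis
          using bound[of "S - {b}"] by blast
      next
        case False
        have "v \<notin> S \<or> a \<notin> S"
          using va \<open>v \<noteq> a\<close> S(2) unfolding indep_def by blast
        then obtain x where "S - {x} = S - {v, a}"
          by blast
        moreover have "card (S - {v, a}) \<le> k"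
          using bound[of "S - {v, a}"] False by blast
        ultimately show ?thesis
          by metis
      qed
      then obtain x where "card (S - {x}) \<le> k"
        by blast
      then show ?thesis
        by (simp add: card_Diff_singleton_if split: if_splits)
    qed
    then show "a \<notin> U \<and> v \<notin> U \<and> insert v (insert a U) \<in> bounded_indep_complex V E (Suc k)"
      using U \<open>v \<in> V\<close> \<open>a \<in> V\<close> unfolding bounded_indep_complex_def by auto
  qed
  then show ?thesis
    by auto
qed

section \<open>Graphs of maximum degree at most two\<close>

lemma card_le_2_not_clique:
  assumes "finite N" "card N \<le> 2" "\<not> clique N E"
  obtains a b where "N = {a, b}" "a \<noteq> b" "{a, b} \<notin> E"
proof -
  obtain a b where ab: "a \<in> N" "b \<in> N" "a \<noteq> b" "{a, b} \<notin> E"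
    using assms(3) unfolding clique_def by blast
  then have "{a, b} = N"
    using assms by (intro card_seteq) auto
  with ab that show ?thesis
    by metis
qed

text \<open>The vertex \<open>c\<close> trades its neighbour \<open>a\<close> for \<open>b\<close>,
  and \<open>b\<close> trades \<open>v\<close> for \<open>c\<close>; no other vertex gains a
  neighbour.\<close>

lemma card_nbrs_path_replacement:
  assumes "finite V" and deg: "\<forall>x\<in>V. card (nbrs V E x) \<le> 2"
    and "v \<in> V" "a \<in> V" "b \<in> nbrs V E v" "c \<in> nbrs V E a" and x: "x \<in> V - {v, a}"
  shows "card (nbrs (V - {v, a}) (insert {c, b} E) x) \<le> 2"
proof -
  have swap: "card M \<le> 2" if "M \<subseteq> insert z (nbrs V E x - {w})" "w \<in> nbrs V E x" for M z w
  proof -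
    have "finite (nbrs V E x)"
      using \<open>finite V\<close> by (rule finite_nbrs)
    then have "card M \<le> Suc (card (nbrs V E x - {w}))"
      using card_mono[OF _ that(1)] card_insert_le_m1[of "Suc (card (nbrs V E x - {w}))" "nbrs V E x - {w}" z]
      by (simp add: le_trans)
    also have "\<dots> = card (nbrs V E x)"
      using \<open>finite (nbrs V E x)\<close> that(2) by (rule card_Suc_Diff1)
    also have "\<dots> \<le> 2"
      using deg x by simp
    finally show ?thesis .
  qed
  let ?M = "nbrs (V - {v, a}) (insert {c, b} E) x"
  consider "x = c" | "x = b" | "x \<noteq> c" "x \<noteq> b"
    by blast
  then show ?thesis
  proof cases
    case 1
    have "?M \<subseteq> insert b (nbrs V E x - {a})"
      unfolding nbrs_def 1 by (auto simp: doubleton_eq_iff)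
    then show ?thesis
      using swap nbrs_sym[of a V c E] assms 1 by blast
  next
    case 2
    have "?M \<subseteq> insert c (nbrs V E x - {v})"
      unfolding nbrs_def 2 by (auto simp: doubleton_eq_iff)
    then show ?thesis
      using swap nbrs_sym[of v V b E] assms 2 by blast
  next
    case 3
    then have "?M \<subseteq> nbrs V E x"
      unfolding nbrs_def by (auto simp: doubleton_eq_iff)
    then have "card ?M \<le> card (nbrs V E x)"
      by (simp add: card_mono finite_nbrs \<open>finite V\<close>)
    then show ?thesis
      using deg x by (meson DiffD1 le_trans)
  qed
qed

text \<open>Degrees are counted inside \<open>V\<close> and \<open>E\<close> is arbitrary, because
  edges at deleted vertices stay in \<open>E\<close> and the path replacement inserts a new edge.
  The value \<open>k\<close> also varies: deletions keep it, links lower it.\<close>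

theorem bounded_indep_complex_collapses_to_void:
  assumes "finite V" "\<forall>x\<in>V. card (nbrs V E x) \<le> 2"
  shows "collapses_to_void (2 * k) (bounded_indep_complex V E k)"
  using assms
proof (induction "card V" arbitrary: V E k rule: less_induct)
  case (less V E k)
  note fin = \<open>finite V\<close> and deg = \<open>\<forall>x\<in>V. card (nbrs V E x) \<le> 2\<close>
  have smaller: "collapses_to_void (2 * m) (bounded_indep_complex (V - W) E m)"
    if "w \<in> V" "w \<in> W" for w W m
  proof (rule less.hyps)
    show "card (V - W) < card V"
      using that fin by (intro psubset_card_mono) auto
    have "card (nbrs (V - W) E x) \<le> card (nbrs V E x)" for x
      unfolding nbrs_diff by (intro card_mono) (auto simp: finite_nbrs fin)
    then show "\<forall>x\<in>V - W. card (nbrs (V - W) E x) \<le> 2"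
      using deg by (meson DiffD1 le_trans)
  qed (use fin in simp)
  show ?case
  proof (cases k)
    case 0
    then show ?thesis
      using fin by (simp add: bounded_indep_complex_0 collapses_to_void_empty_face)
  next
    case k: (Suc m)
    \<comment> \<open>The deletion of \<open>v\<close> is covered by induction with the same
      \<open>k\<close>. Since \<open>2 * k = 2 * m + 2\<close>, the link of \<open>v\<close> may use
      dimension \<open>2 * m + 1\<close>.\<close>
    have step: ?thesis if "v \<in> V"
      "collapses_to_void (Suc (2 * m)) {U. v \<notin> U \<and> insert v U \<in> bounded_indep_complex V E k}" for v
      using collapses_to_void_deletion_link[of "Suc (2 * m)" "bounded_indep_complex V E k" v]
        smaller[of v "{v}" k] that
      by (simp add: bounded_indep_complex_deletion k)
    consider "V = {}" | v where "v \<in> V" "clique (nbrs V E v) E"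
      | v where "v \<in> V" "\<forall>x\<in>V. \<not> clique (nbrs V E x) E"
      by blast
    then show ?thesis
    proof cases
      case 1
      then have "bounded_indep_complex V E k = {{}}"
        unfolding bounded_indep_complex_def by auto
      then show ?thesis
        by (simp add: collapses_to_void_empty_face)
    next
      case (2 v)
      \<comment> \<open>Induction even gives \<open>2 * m\<close> here; a vertex whose neighbourhood
        is a clique costs only one dimension.\<close>
      have "collapses_to_void (Suc (2 * m)) (bounded_indep_complex (V - insert v (nbrs V E v)) E m)"
        using smaller[of v "insert v (nbrs V E v)" m] 2 collapses_to_void_mono by fastforce
      then show ?thesis
        using step[of v] simplicial_link_collapses_to_void[of V v E] fin 2 unfolding k by blast
    next
      case (3 v)
      obtain a b where ab: "nbrs V E v = {a, b}" "a \<noteq> b" "{a, b} \<notin> E"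
        using card_le_2_not_clique 3 deg fin finite_nbrs by metis
      have "a \<in> V" "v \<in> nbrs V E a" "v \<noteq> a" "v \<noteq> b" "{v, b} \<in> E"
        using ab nbrs_sym[of v V a E] 3 unfolding nbrs_def by auto
      obtain p q where pq: "nbrs V E a = {p, q}" "p \<noteq> q" "{p, q} \<notin> E"
        using card_le_2_not_clique 3 deg fin finite_nbrs \<open>a \<in> V\<close> by metis
      obtain c where c: "nbrs V E a = {v, c}" "c \<noteq> v" "{v, c} \<notin> E"
        using pq \<open>v \<in> nbrs V E a\<close> by (auto simp: insert_commute)
      \<comment> \<open>\<open>v\<close> is adjacent to \<open>b\<close> but not to
        \<open>c\<close>. Hence the edge \<open>{c, b}\<close> inserted below is a genuine
        pair.\<close>
      then have "b \<noteq> c"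
        using \<open>{v, b} \<in> E\<close> by auto
      \<comment> \<open>The link of \<open>v\<close> is split once more, at \<open>a\<close>; this
        second split spends the second dimension and leaves \<open>2 * m\<close> for the link of
        \<open>a\<close> in \<open>?Y\<close>.\<close>
      let ?Y = "{U. v \<notin> U \<and> insert v U \<in> bounded_indep_complex V E k}"
      let ?W = "V - {a}"
      have "collapses_to_void (Suc (2 * m)) {U \<in> ?Y. a \<notin> U}"
      proof -
        have "nbrs ?W E v = {b}"
          using ab by (auto simp: nbrs_diff)
        moreover have "?W - {v, b} = V - {a, v, b}"
          by auto
        ultimately have "collapses_to_void (2 * m)
            {U. v \<notin> U \<and> insert v U \<in> bounded_indep_complex ?W E (Suc m)}"
          using simplicial_link_collapses_to_void[of ?W v E "2 * m" m] fin \<open>v \<in> V\<close> \<open>v \<noteq> a\<close>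
            smaller[of v "{a, v, b}" m]
          by (simp add: clique_def)
        moreover have "{U. v \<notin> U \<and> insert v U \<in> bounded_indep_complex ?W E (Suc m)} = {U \<in> ?Y. a \<notin> U}"
          using \<open>v \<noteq> a\<close> unfolding k bounded_indep_complex_deletion[symmetric] by auto
        ultimately show ?thesis
          using collapses_to_void_mono[of "2 * m" _ "Suc (2 * m)"] by simp
      qed
      moreover have "collapses_to_void (2 * m) {U. a \<notin> U \<and> insert a U \<in> ?Y}"
      proof -
        have "{U. a \<notin> U \<and> insert a U \<in> ?Y} = bounded_indep_complex (V - {v, a}) (insert {c, b} E) m"
          using bounded_indep_complex_path_link[of V v a E b c m] fin 3 \<open>a \<in> V\<close> ab c \<open>b \<noteq> c\<close> \<open>v \<noteq> a\<close> k
          by auto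
        \<comment> \<open>The edge set changes here, so the induction hypothesis is applied directly
          instead of through \<open>smaller\<close>.\<close>
        moreover have "collapses_to_void (2 * m) \<dots>"
        proof (rule less.hyps)
          show "card (V - {v, a}) < card V"
            using \<open>v \<in> V\<close> fin by (intro psubset_card_mono) auto
          show "\<forall>x\<in>V - {v, a}. card (nbrs (V - {v, a}) (insert {c, b} E) x) \<le> 2"
            using card_nbrs_path_replacement[of V E v a b c] fin deg \<open>v \<in> V\<close> \<open>a \<in> V\<close> ab c by auto
        qed (use fin in simp)
        ultimately show ?thesis
          by simp
      qed
      ultimately have "collapses_to_void (Suc (2 * m)) ?Y"
        by (rule collapses_to_void_deletion_link)
      then show ?thesis
        using step \<open>v \<in> V\<close> by blast
    qed
  qed
qed

section \<open>Passage from the given definitions to neighbourhoods and bounded independent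
  sets\<close>

text \<open>Sending a neighbour \<open>y\<close> to the edge \<open>{x, y}\<close> is injective, so
  neighbours are at most as many as incident edges.\<close>

lemma card_nbrs_le_max_degree:
  assumes "finite_graph V E" "x \<in> V"
  shows "card (nbrs V E x) \<le> max_degree V E"
proof -
  have "finite V" "finite E"
    using assms(1) unfolding finite_graph_def nsets_def
    by (auto intro: finite_subset[of E "Pow V"])
  have "card (nbrs V E x) \<le> vertex_degree E x"
    unfolding vertex_degree_def
  proof (rule card_inj_on_le)
    show "inj_on (\<lambda>y. {x, y}) (nbrs V E x)"
      by (auto simp: inj_on_def doubleton_eq_iff)
    show "(\<lambda>y. {x, y}) ` nbrs V E x \<subseteq> {e \<in> E. x \<in> e}"
      by (auto simp: nbrs_def)
  qed (use \<open>finite E\<close> in simp)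
  also have "\<dots> \<le> max_degree V E"
    unfolding max_degree_def using \<open>finite V\<close> \<open>x \<in> V\<close> by (intro Max_ge) auto
  finally show ?thesis .
qed

text \<open>The empty set is independent, so \<open>Max\<close> ranges over a finite nonempty set
  and is below \<open>n\<close> exactly when all its elements are. With \<open>n \<ge> 1\<close> the
  subtraction in \<open>n - 1\<close> does not truncate.\<close>

lemma independence_complex_eq_bounded_indep_complex:
  assumes "finite V" "n \<ge> 1"
  shows "independence_complex n V E = bounded_indep_complex V E (n - 1)"
proof -
  have "independence_number U (induced_edges E U) < n \<longleftrightarrow>
      (\<forall>S\<subseteq>U. indep S E \<longrightarrow> card S \<le> n - 1)" if "U \<subseteq> V" for U
  proof -
    have indep_iff: "indep S (induced_edges E U) \<longleftrightarrow> indep S E" if "S \<subseteq> U" for S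
      using that unfolding indep_def induced_edges_def by auto
    let ?I = "{S. S \<subseteq> U \<and> indep S (induced_edges E U)}"
    have "finite ?I"
      using that assms(1) by (auto intro: finite_subset[of ?I "Pow V"])
    moreover have "{} \<in> ?I"
      by (simp add: indep_def)
    ultimately have "independence_number U (induced_edges E U) < n \<longleftrightarrow> (\<forall>S\<in>?I. card S < n)"
      unfolding independence_number_def by (subst Max_less_iff) auto
    moreover have "card S < n \<longleftrightarrow> card S \<le> n - 1" for S :: "'a set"
      using assms(2) by linarith
    ultimately show ?thesis
      using indep_iff by auto
  qed
  then show ?thesis
    unfolding independence_complex_def bounded_indep_complex_def by blast
qed

lemma finite_complex_bounded_indep_complex:
  assumes "finite V"
  shows "finite_complex (bounded_indep_complex V E k)"
proof -
  have "bounded_indep_complex V E k \<subseteq> Pow V"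
    unfolding bounded_indep_complex_def by auto
  then have "finite (bounded_indep_complex V E k)"
    and "\<forall>\<sigma>\<in>bounded_indep_complex V E k. finite \<sigma>"
    using assms by (auto intro: finite_subset)
  then show ?thesis
    unfolding finite_complex_def bounded_indep_complex_def by blast
qed

theorem theorem5p2:
  fixes V :: "'a set" and E :: "'a set set" and n :: nat
  assumes "finite_graph V E"
    and "max_degree V E \<le> 2"
    and "n \<ge> 1"
  shows "collapsible (2 * (n - 1)) (independence_complex n V E)"
proof -
  have "finite V"
    using assms(1) unfolding finite_graph_def by simp
  moreover have "\<forall>x\<in>V. card (nbrs V E x) \<le> 2"
    using card_nbrs_le_max_degree[OF assms(1)] assms(2) le_trans by blast
  ultimately show ?thesis
    using bounded_indep_complex_collapses_to_void finite_complex_bounded_indep_complex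
    unfolding collapsible_def collapses_to_void_def
      independence_complex_eq_bounded_indep_complex[OF \<open>finite V\<close> assms(3)]
    by blast
qed

end
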